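(* Let $m\ge 1$ be an integer and let $F_m$ be the friendship graph consisting of $m$ triangles sharing a common vertex. Then $$\mathcal{L}(F_m)=\frac{(4m-1)\,(2m)!}{2m-1}.$$
   Context: Let $H$ be a finite, connected, undirected graph with vertex set $V$. A random walk labeling of $H$ is a labeling of $V$ obtainable by the following process: (1) set $i=1$, choose any $v\in V$ and label $v$ with $i$; (2) as long as there are unlabeled vertices, choose a vertex $w$ adjacent to the current vertex $v$ and replace $v$ by $w$; if this new $v$ is not labeled, increase $i$ by $1$ and label $v$ with $i$. The number of different random walk labelings of $H$ is denoted by $\mathcal{L}(H)$. The friendship graph $F_m$ is the one-point union of $m$ copies of the cycle graph $C_3$: it is obtained from $m$ disjoint triangles by choosing one vertex in each and identifying all the chosen vertices to a single vertex (so it has $2m+1$ vertices). *)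

theory Defs
  imports Complex_Main "Graph_Theory.Graph_Theory"
begin

text \<open>
  An undirected graph is a symmetric digraph without parallel arcs: \<open>w\<close> is adjacent to \<open>v\<close>
  iff \<open>(v, w) \<in> parcs H\<close>. A state \<open>(v, i, l)\<close> of the process consists of the current vertex,
  the last label used and the partial labeling \<open>l\<close>, whose domain is the set of labeled vertices.
\<close>

inductive random_walk_process ::
    "'a pair_pre_digraph \<Rightarrow> 'a \<Rightarrow> nat \<Rightarrow> ('a \<rightharpoonup> nat) \<Rightarrow> bool"
  for H :: "'a pair_pre_digraph" where
  start: "v \<in> pverts H \<Longrightarrow> random_walk_process H v 1 [v \<mapsto> 1]"
| step_new: "\<lbrakk>random_walk_process H v i l; dom l \<noteq> pverts H; (v, w) \<in> parcs H; w \<notin> dom l\<rbrakk>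
    \<Longrightarrow> random_walk_process H w (i + 1) (l(w \<mapsto> i + 1))"
| step_old: "\<lbrakk>random_walk_process H v i l; dom l \<noteq> pverts H; (v, w) \<in> parcs H; w \<in> dom l\<rbrakk>
    \<Longrightarrow> random_walk_process H w i l"

definition random_walk_labelings :: "'a pair_pre_digraph \<Rightarrow> ('a \<rightharpoonup> nat) set" where
  "random_walk_labelings H = {l. \<exists>v i. random_walk_process H v i l \<and> dom l = pverts H}"

definition num_random_walk_labelings :: "'a pair_pre_digraph \<Rightarrow> nat" where
  "num_random_walk_labelings H = card (random_walk_labelings H)"

definition disjoint_triangles :: "nat \<Rightarrow> (nat \<times> nat) pair_pre_digraph" where
  "disjoint_triangles m = \<lparr>
     pverts = {..<m} \<times> {..<3},
     parcs = {((k, i), (k, j)) | k i j. k < m \<and> i < 3 \<and> j < 3 \<and> i \<noteq> j} \<rparr>"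

text \<open>
  The chosen vertex of the \<open>k\<close>-th triangle is \<open>(k, 0)\<close>; identifying the chosen vertices means
  sending all of them to the representative \<open>(0, 0)\<close>.
\<close>

definition identify_chosen :: "nat \<times> nat \<Rightarrow> nat \<times> nat" where
  "identify_chosen x = (if snd x = 0 then (0, 0) else x)"

definition friendship_graph :: "nat \<Rightarrow> (nat \<times> nat) pair_pre_digraph" where
  "friendship_graph m = \<lparr>
     pverts = identify_chosen ` pverts (disjoint_triangles m),
     parcs = map_prod identify_chosen identify_chosen ` parcs (disjoint_triangles m) \<rparr>"

lemma pverts_friendship_graph:
  assumes "m \<ge> 1"
  shows "pverts (friendship_graph m) = insert (0, 0) ({..<m} \<times> {1, 2})"
proof
  show "pverts (friendship_graph m) \<subseteq> insert (0, 0) ({..<m} \<times> {1, 2})"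
    by (auto simp: friendship_graph_def disjoint_triangles_def identify_chosen_def)
  show "insert (0, 0) ({..<m} \<times> {1, 2}) \<subseteq> pverts (friendship_graph m)"
  proof
    fix x :: "nat \<times> nat" assume x: "x \<in> insert (0, 0) ({..<m} \<times> {1, 2})"
    then have "x = identify_chosen x" "x \<in> pverts (disjoint_triangles m)"
      using assms by (auto simp: disjoint_triangles_def identify_chosen_def)
    then show "x \<in> pverts (friendship_graph m)"
      unfolding friendship_graph_def by auto
  qed
qed

lemma card_pverts_friendship_graph:
  assumes "m \<ge> 1"
  shows "card (pverts (friendship_graph m)) = 2 * m + 1"
proof -
  have "(0, 0) \<notin> {..<m} \<times> {1, 2 :: nat}" by simp
  then show ?thesis
    by (simp add: pverts_friendship_graph[OF assms] card_cartesian_product)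
qed

lemma pair_graph_friendship_graph: "pair_graph (friendship_graph m)"
proof -
  have fin: "finite (pverts (disjoint_triangles m))"
    by (simp add: disjoint_triangles_def)
  have sub: "parcs (disjoint_triangles m) \<subseteq>
      pverts (disjoint_triangles m) \<times> pverts (disjoint_triangles m)"
    by (auto simp: disjoint_triangles_def)
  have fin': "finite (parcs (disjoint_triangles m))"
    using finite_subset[OF sub] fin by simp
  have sym: "sym (parcs (friendship_graph m))"
  proof (rule symI)
    fix x y assume "(x, y) \<in> parcs (friendship_graph m)"
    then obtain a b where ab: "(a, b) \<in> parcs (disjoint_triangles m)"
      "x = identify_chosen a" "y = identify_chosen b"
      by (auto simp: friendship_graph_def)
    then have "(b, a) \<in> parcs (disjoint_triangles m)"
      by (auto simp: disjoint_triangles_def)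
    then show "(y, x) \<in> parcs (friendship_graph m)"
      using ab by (force simp: friendship_graph_def)
  qed
  show ?thesis
  proof unfold_locales
    show "symmetric (with_proj (friendship_graph m))"
      using sym by (simp add: symmetric_def)
    show "fst e \<noteq> snd e" if "e \<in> parcs (friendship_graph m)" for e
      using that
      by (auto simp: friendship_graph_def disjoint_triangles_def identify_chosen_def split: if_splits)
    show "fst e \<in> pverts (friendship_graph m)" if "e \<in> parcs (friendship_graph m)" for e
      using that sub by (auto simp: friendship_graph_def)
    show "snd e \<in> pverts (friendship_graph m)" if "e \<in> parcs (friendship_graph m)" for e
      using that sub by (auto simp: friendship_graph_def)
  qed (use fin fin' in \<open>simp_all add: friendship_graph_def\<close>)
qed

lemma connected_friendship_graph:
  assumes "m \<ge> 1"
  shows "Digraph_Component.connected (with_proj (friendship_graph m))"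
proof -
  interpret pair_graph "friendship_graph m" by (rule pair_graph_friendship_graph)
  let ?F = "with_proj (friendship_graph m)"
  have adj: "((0, 0), x) \<in> parcs (friendship_graph m)" if x: "x \<in> {..<m} \<times> {1, 2}" for x
  proof -
    have "((fst x, 0), x) \<in> parcs (disjoint_triangles m)"
      using x by (auto simp: disjoint_triangles_def)
    then have "map_prod identify_chosen identify_chosen ((fst x, 0), x)
        \<in> parcs (friendship_graph m)"
      unfolding friendship_graph_def by auto
    then show ?thesis using x by (auto simp: identify_chosen_def)
  qed
  have from0: "(0, 0) \<rightarrow>\<^sup>*\<^bsub>?F\<^esub> x" if "x \<in> pverts (friendship_graph m)" for x
  proof (cases "x = (0, 0)")
    case True
    then show ?thesis using that by simp
  next
    case False
    then have "((0, 0), x) \<in> parcs (friendship_graph m)"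
      using that adj pverts_friendship_graph[OF assms] by blast
    then show ?thesis using reachable_adjI by simp
  qed
  have "strongly_connected ?F"
  proof (rule strongly_connectedI)
    show "verts ?F \<noteq> {}" using pverts_friendship_graph[OF assms] by simp
    fix u v assume "u \<in> verts ?F" "v \<in> verts ?F"
    then show "u \<rightarrow>\<^sup>*\<^bsub>?F\<^esub> v"
      using from0 symmetric_reachable' reachable_trans by (metis with_proj_simps(1))
  qed
  then show ?thesis
    using reachable_mk_symmetric_eq sym_arcs
    by (simp add: Digraph_Component.connected_def strongly_connected_def)
qed

end

theory Submission
  imports Defs "HOL-Combinatorics.Multiset_Permutations"
begin

text \<open>
  A labeling is determined by the order in which the vertices are first visited, and since the
  walk may return to any visited vertex through visited ones, the possible orders are those in
  which every vertex but the first has an earlier neighbour. In \<open>F\<^sub>m\<close> the vertices after the centre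
  come in arbitrary order, and at most two vertices precede it: no vertex (\<open>(2m)!\<close> orders), one
  vertex (\<open>2m \<cdot> (2m - 1)!\<close> orders), or a vertex followed by its mate in the same triangle
  (\<open>2m \<cdot> (2m - 2)!\<close> orders).
\<close>

section \<open>Labelings as exploration orders\<close>

text \<open>The visited set is an argument so that a tail of an order can be judged on its own, in
  particular the tail after the centre.\<close>

fun explores :: "'a pair_pre_digraph \<Rightarrow> 'a set \<Rightarrow> 'a list \<Rightarrow> bool" where
  "explores H A [] \<longleftrightarrow> True"
| "explores H A (x # xs) \<longleftrightarrow>
     x \<notin> A \<and> (\<exists>u\<in>A. (u, x) \<in> parcs H) \<and> explores H (insert x A) xs"

definition exploration_orders :: "'a pair_pre_digraph \<Rightarrow> 'a list set" where
  "exploration_orders H =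
     {v # xs | v xs. v \<in> pverts H \<and> explores H {v} xs \<and> set (v # xs) = pverts H}"

definition order_labeling :: "'a list \<Rightarrow> ('a \<rightharpoonup> nat)" where
  "order_labeling xs = map_of (zip xs [1..<Suc (length xs)])"

text \<open>The recursion consumes a list from the front, but a walk discovers vertices at the end;
  this form serves the inductions along a walk.\<close>

lemma explores_snoc:
  "explores H A (xs @ [w]) \<longleftrightarrow>
     explores H A xs \<and> w \<notin> A \<union> set xs \<and> (\<exists>u\<in>A \<union> set xs. (u, w) \<in> parcs H)"
  by (induction xs arbitrary: A) auto

lemma explores_distinct: "explores H A xs \<Longrightarrow> distinct xs \<and> set xs \<inter> A = {}"
  by (induction xs arbitrary: A) auto

lemma dom_order_labeling [simp]: "dom (order_labeling xs) = set xs"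
  unfolding order_labeling_def by (rule dom_map_of_zip) (simp del: upt_Suc)

lemma order_labeling_snoc:
  assumes "w \<notin> set xs"
  shows "order_labeling (xs @ [w]) = (order_labeling xs)(w \<mapsto> length xs + 1)"
proof -
  have upt: "[1..<Suc (length (xs @ [w]))] = [1..<Suc (length xs)] @ [length xs + 1]" by simp
  have "order_labeling (xs @ [w]) = [w \<mapsto> length xs + 1] ++ order_labeling xs"
    unfolding order_labeling_def upt by (simp del: upt_Suc)
  \<comment> \<open>In \<open>++\<close> the right map takes precedence; the swap is sound because
    \<open>w\<close> is outside the domain of the other map.\<close>
  also have "\<dots> = (order_labeling xs)(w \<mapsto> length xs + 1)"
    using assms by (subst map_add_comm) auto
  finally show ?thesis .
qed

lemma order_labeling_single: "order_labeling [a] = [a \<mapsto> 1]"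
  using order_labeling_snoc[of a "[]"] by (simp add: order_labeling_def)

lemma order_labeling_nth:
  assumes "distinct xs" "i < length xs"
  shows "order_labeling xs (xs ! i) = Some (Suc i)"
  using assms map_of_zip_nth[of xs "[1..<Suc (length xs)]" i]
  by (simp add: order_labeling_def nth_upt del: upt_Suc)

text \<open>The label of an entry is its position plus one, so a list without repetitions can be
  read back from its labeling.\<close>

lemma inj_on_order_labeling: "inj_on order_labeling {xs. distinct xs}"
proof (rule inj_onI)
  fix xs ys :: "'a list"
  assume "xs \<in> {xs. distinct xs}" "ys \<in> {xs. distinct xs}"
    and eq: "order_labeling xs = order_labeling ys"
  then have d: "distinct xs" "distinct ys" by auto
  have s: "set xs = set ys" using eq dom_order_labeling by metis
  then have len: "length xs = length ys" using d distinct_card by metis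
  show "xs = ys"
  proof (rule nth_equalityI[OF len])
    fix i assume i: "i < length xs"
    then obtain j where j: "j < length ys" "xs ! i = ys ! j"
      using s by (metis in_set_conv_nth)
    then have "i = j"
      using order_labeling_nth[OF d(1) i] order_labeling_nth[OF d(2) j(1)] eq by simp
    then show "xs ! i = ys ! i" using j by simp
  qed
qed

text \<open>An invariant of the process: \<open>step_new\<close> appends \<open>w\<close> to the
  order, and \<open>step_old\<close> changes only the current vertex. Tracking \<open>i\<close> as
  the length makes the next label the one that \<open>order_labeling\<close> gives.\<close>

lemma random_walk_process_exploration:
  assumes "parcs H \<subseteq> pverts H \<times> pverts H" "random_walk_process H v i l"
  shows "\<exists>a xs. a \<in> pverts H \<and> explores H {a} xs \<and> v \<in> set (a # xs) \<and>
           i = length (a # xs) \<and> l = order_labeling (a # xs)"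
  using assms(2)
proof (induction rule: random_walk_process.induct)
  case (start v)
  then show ?case
    by (intro exI[of _ v] exI[of _ "[]"]) (auto simp: order_labeling_single)
next
  case (step_new v i l w)
  then obtain a xs where a: "a \<in> pverts H" "explores H {a} xs" "v \<in> set (a # xs)"
    "i = length (a # xs)" "l = order_labeling (a # xs)" by blast
  then have w: "w \<notin> set (a # xs)" using step_new.hyps by (metis dom_order_labeling)
  have "l(w \<mapsto> i + 1) = order_labeling (a # xs @ [w])"
    using order_labeling_snoc[OF w] a by simp
  moreover have "explores H {a} (xs @ [w])"
    using a w step_new.hyps by (auto simp: explores_snoc)
  ultimately show ?case
    using a by (intro exI[of _ a] exI[of _ "xs @ [w]"]) auto
next
  case (step_old v i l w)
  then show ?case by (metis dom_order_labeling)
qed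

text \<open>Each new vertex is joined to an earlier one by arcs in both directions, so the visited
  set stays strongly connected. The arcs are restricted to that set so that a walk along them meets
  no unlabeled vertex.\<close>

lemma explores_connected:
  assumes "sym (parcs H)" "explores H {a} xs"
  shows "set (a # xs) \<times> set (a # xs) \<subseteq> (parcs H \<inter> set (a # xs) \<times> set (a # xs))\<^sup>*"
  using assms(2)
proof (induction xs rule: rev_induct)
  case Nil
  then show ?case by auto
next
  case (snoc w xs)
  let ?E = "parcs H \<inter> set (a # xs) \<times> set (a # xs)"
  let ?E' = "parcs H \<inter> set (a # xs @ [w]) \<times> set (a # xs @ [w])"
  have IH: "set (a # xs) \<times> set (a # xs) \<subseteq> ?E\<^sup>*" using snoc by (simp add: explores_snoc)
  have mono: "?E\<^sup>* \<subseteq> ?E'\<^sup>*" by (rule rtrancl_mono) auto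
  obtain u where u: "u \<in> set (a # xs)" "(u, w) \<in> parcs H"
    using snoc.prems by (auto simp: explores_snoc)
  then have arcs: "(u, w) \<in> ?E'" "(w, u) \<in> ?E'"
    using assms(1) by (auto dest: symD)
  \<comment> \<open>Every vertex is connected with \<open>u\<close> both ways, so any two are
    connected through \<open>u\<close>.\<close>
  have to_u: "(x, u) \<in> ?E'\<^sup>*" and from_u: "(u, x) \<in> ?E'\<^sup>*" if "x \<in> set (a # xs @ [w])" for x
  proof -
    from that have "x = w \<or> x \<in> set (a # xs)" by auto
    then have "(x, u) \<in> ?E'\<^sup>* \<and> (u, x) \<in> ?E'\<^sup>*"
    proof
      assume "x = w"
      then show ?thesis using arcs by blast
    next
      assume "x \<in> set (a # xs)"
      then show ?thesis using IH mono u(1) by blast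
    qed
    then show "(x, u) \<in> ?E'\<^sup>*" "(u, x) \<in> ?E'\<^sup>*" by auto
  qed
  show ?case
    using rtrancl_trans[OF to_u from_u] by auto
qed

lemma random_walk_process_return:
  assumes "random_walk_process H v i l" "dom l \<noteq> pverts H"
    and "(v, u) \<in> (parcs H \<inter> dom l \<times> dom l)\<^sup>*"
  shows "random_walk_process H u i l"
  using assms(3)
  by (induction rule: rtrancl_induct) (use assms in \<open>auto intro: random_walk_process.step_old\<close>)

text \<open>The walk stands at the latest vertex; before each discovery it returns through labeled
  vertices to an earlier neighbour of the next vertex.\<close>

lemma exploration_random_walk_process:
  assumes "sym (parcs H)" "parcs H \<subseteq> pverts H \<times> pverts H"
    and "a \<in> pverts H" "explores H {a} xs"
  shows "random_walk_process H (last (a # xs)) (length (a # xs)) (order_labeling (a # xs))"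
  using assms(4)
proof (induction xs rule: rev_induct)
  case Nil
  then show ?case
    using random_walk_process.start[OF assms(3)] unfolding order_labeling_single
    by (simp del: fun_upd_apply)
next
  case (snoc w xs)
  let ?l = "order_labeling (a # xs)"
  have ex: "explores H {a} xs" and w: "w \<notin> set (a # xs)"
    using snoc.prems by (auto simp: explores_snoc)
  obtain u where u: "u \<in> set (a # xs)" "(u, w) \<in> parcs H"
    using snoc.prems by (auto simp: explores_snoc)
  \<comment> \<open>As the head of an arc, \<open>w\<close> is a vertex, so the labeling is still
    incomplete and the process may continue.\<close>
  have ne: "dom ?l \<noteq> pverts H" using assms(2) u(2) w by auto
  have "(last (a # xs), u) \<in> (parcs H \<inter> dom ?l \<times> dom ?l)\<^sup>*"
    using explores_connected[OF assms(1) ex] u(1) last_in_set[of "a # xs"]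
    by (simp only: dom_order_labeling) blast
  with snoc.IH[OF ex] ne have "random_walk_process H u (length (a # xs)) ?l"
    by (rule random_walk_process_return)
  from random_walk_process.step_new[OF this ne u(2)] show ?case
    using w order_labeling_snoc[OF w] by (simp del: fun_upd_apply)
qed

lemma random_walk_labelings_eq:
  assumes "sym (parcs H)" "parcs H \<subseteq> pverts H \<times> pverts H"
  shows "random_walk_labelings H = order_labeling ` exploration_orders H"
proof (intro equalityI subsetI)
  fix l assume "l \<in> random_walk_labelings H"
  then obtain v i where "random_walk_process H v i l" and dom: "dom l = pverts H"
    by (auto simp: random_walk_labelings_def)
  from random_walk_process_exploration[OF assms(2) this(1)] obtain a xs
    where a: "a \<in> pverts H" "explores H {a} xs" "l = order_labeling (a # xs)" by blast
  then have "set (a # xs) = pverts H" using dom by (metis dom_order_labeling)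
  then show "l \<in> order_labeling ` exploration_orders H"
    unfolding exploration_orders_def using a by blast
next
  fix l assume "l \<in> order_labeling ` exploration_orders H"
  then obtain a xs where a: "a \<in> pverts H" "explores H {a} xs" "set (a # xs) = pverts H"
    and l: "l = order_labeling (a # xs)" unfolding exploration_orders_def by blast
  have "dom l = pverts H" using a l by (metis dom_order_labeling)
  then show "l \<in> random_walk_labelings H"
    unfolding random_walk_labelings_def l
    using exploration_random_walk_process[OF assms a(1,2)] by blast
qed

lemma num_random_walk_labelings_eq:
  assumes "sym (parcs H)" "parcs H \<subseteq> pverts H \<times> pverts H"
  shows "num_random_walk_labelings H = card (exploration_orders H)"
proof -
  have "exploration_orders H \<subseteq> {xs. distinct xs}"
    unfolding exploration_orders_def by (auto dest!: explores_distinct)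
  then have "inj_on order_labeling (exploration_orders H)"
    by (rule inj_on_subset[OF inj_on_order_labeling])
  then show ?thesis
    by (simp add: num_random_walk_labelings_def random_walk_labelings_eq[OF assms] card_image)
qed

section \<open>Exploration orders of the friendship graph\<close>

abbreviation rim :: "nat \<Rightarrow> (nat \<times> nat) set" where
  "rim m \<equiv> {..<m} \<times> {1, 2}"

text \<open>Subtraction from 3 swaps the two rim positions 1 and 2 of a triangle.\<close>

definition mate :: "nat \<times> nat \<Rightarrow> nat \<times> nat" where
  "mate x = (fst x, 3 - snd x)"

lemma mate_rim: "x \<in> rim m \<Longrightarrow> mate x \<in> rim m \<and> mate x \<noteq> x"
  by (auto simp: mate_def)

lemma card_rim: "card (rim m) = 2 * m"
  by (simp add: card_cartesian_product)

lemma parcs_friendship_graph: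
  "(x, y) \<in> parcs (friendship_graph m) \<longleftrightarrow>
     x = (0, 0) \<and> y \<in> rim m \<or> x \<in> rim m \<and> y = (0, 0) \<or> x \<in> rim m \<and> y = mate x"
  (is "?L \<longleftrightarrow> ?R")
proof
  assume ?L
  then show ?R
    by (auto simp: friendship_graph_def disjoint_triangles_def identify_chosen_def mate_def
        less_Suc_eq numeral_3_eq_3 split: if_splits)
next
  have arc: "(identify_chosen (k, i), identify_chosen (k, j)) \<in> parcs (friendship_graph m)"
    if "k < m" "i < 3" "j < 3" "i \<noteq> j" for k i j
  proof -
    have "((k, i), (k, j)) \<in> parcs (disjoint_triangles m)"
      using that by (auto simp: disjoint_triangles_def)
    then show ?thesis by (force simp: friendship_graph_def)
  qed
  assume ?R
  then show ?L
    \<comment> \<open>The instances are the arc from the rim to the centre, the arc from the centre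
      to the rim, and the arc between mates.\<close>
    using arc[of "fst x" "snd x" 0] arc[of "fst y" 0 "snd y"] arc[of "fst x" "snd x" "3 - snd x"]
    by (auto simp: identify_chosen_def mate_def)
qed

text \<open>The centre is adjacent to the whole rim, so once it is visited, only repetitions can
  spoil an order.\<close>

lemma explores_friendship_graph_centre:
  assumes "(0, 0) \<in> A" "set xs \<subseteq> insert (0, 0) (rim m)"
  shows "explores (friendship_graph m) A xs \<longleftrightarrow> distinct xs \<and> set xs \<inter> A = {}"
  using assms
proof (induction xs arbitrary: A)
  case (Cons x xs)
  have "\<exists>u\<in>A. (u, x) \<in> parcs (friendship_graph m)" if "x \<notin> A"
    using that Cons.prems by (intro bexI[of _ "(0, 0)"]) (auto simp: parcs_friendship_graph)
  then show ?case using Cons by auto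
qed simp

lemma exploration_orders_friendship_graph:
  assumes "m \<ge> 1"
  shows "exploration_orders (friendship_graph m) =
      (\<lambda>xs. (0, 0) # xs) ` permutations_of_set (rim m)
    \<union> (\<lambda>(v, xs). v # (0, 0) # xs) ` (SIGMA v:rim m. permutations_of_set (rim m - {v}))
    \<union> (\<lambda>(v, xs). v # mate v # (0, 0) # xs) `
        (SIGMA v:rim m. permutations_of_set (rim m - {v, mate v}))"
    (is "?O = ?A \<union> ?B \<union> ?C")
proof (intro equalityI subsetI)
  let ?F = "friendship_graph m" and ?V = "insert (0, 0) (rim m)"
  note V = pverts_friendship_graph[OF assms]
  fix zs assume "zs \<in> ?O"
  then obtain v xs where zs: "zs = v # xs" and v: "v \<in> ?V" and ex: "explores ?F {v} xs"
    and set: "set (v # xs) = ?V"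
    unfolding exploration_orders_def V by blast
  have d: "distinct (v # xs)" using explores_distinct[OF ex] by auto
  show "zs \<in> ?A \<union> ?B \<union> ?C"
  proof (cases "v = (0, 0)")
    case True
    have "set xs = set (v # xs) - {v}" using d by auto
    also have "\<dots> = rim m" unfolding set using True by auto
    finally show ?thesis using d zs True by (auto simp: permutations_of_set_def)
  next
    case False
    then have vr: "v \<in> rim m" using v by auto
    \<comment> \<open>The order covers the centre, and \<open>v\<close> is not the centre, so
      something must follow \<open>v\<close>.\<close>
    obtain x ys where xs: "xs = x # ys" using False set by (cases xs) auto
    have "(v, x) \<in> parcs ?F" using ex xs by auto
    then consider "x = (0, 0)" | "x = mate v" using False by (auto simp: parcs_friendship_graph)
    then show ?thesis
    proof cases
      case 1
      have "set ys = set (v # xs) - {v, x}" using d xs by auto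
      also have "\<dots> = rim m - {v}" unfolding set 1 by auto
      finally have "(v, ys) \<in> (SIGMA v:rim m. permutations_of_set (rim m - {v}))"
        using d xs vr by (auto simp: permutations_of_set_def)
      then show ?thesis using zs xs 1 by force
    next
      case 2
      have x0: "x \<noteq> (0, 0)" using mate_rim[OF vr] 2 by auto
      have "(0, 0) \<in> set (v # xs)" unfolding set by simp
      then obtain y ws where ys: "ys = y # ws" using False xs x0 by (cases ys) auto
      have "(v, y) \<in> parcs ?F \<or> (x, y) \<in> parcs ?F" "y \<noteq> v" "y \<noteq> x" using ex xs ys by auto
      \<comment> \<open>The only rim neighbours of \<open>v\<close> and \<open>x\<close> are each
        other, both already visited, so the third vertex has to be the centre.\<close>
      moreover have "mate x = v" using vr 2 by (auto simp: mate_def)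
      ultimately have y: "y = (0, 0)"
        using False x0 2 by (auto simp: parcs_friendship_graph)
      have "set ws = set (v # xs) - {v, x, y}" using d xs ys by auto
      also have "\<dots> = rim m - {v, mate v}" unfolding set y 2 by auto
      finally have "(v, ws) \<in> (SIGMA v:rim m. permutations_of_set (rim m - {v, mate v}))"
        using d xs ys vr by (auto simp: permutations_of_set_def)
      then show ?thesis using zs xs ys y 2 by force
    qed
  qed
next
  let ?F = "friendship_graph m" and ?V = "insert (0, 0) (rim m)"
  note V = pverts_friendship_graph[OF assms]
  note centre = explores_friendship_graph_centre[where m = m]
  fix zs assume "zs \<in> ?A \<union> ?B \<union> ?C"
  then show "zs \<in> ?O"
  proof (elim UnE)
    assume "zs \<in> ?A"
    then obtain xs where A: "zs = (0, 0) # xs" "set xs = rim m" "distinct xs"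
      by (auto simp: permutations_of_set_def)
    then have "explores ?F {(0, 0)} xs" by (subst centre) auto
    then show ?thesis using A unfolding exploration_orders_def V by auto
  next
    assume "zs \<in> ?B"
    then obtain v xs where B: "zs = v # (0, 0) # xs" "v \<in> rim m" "set xs = rim m - {v}"
      "distinct xs"
      by (elim imageE SigmaE) (simp add: permutations_of_set_def)
    have "explores ?F {(0, 0), v} xs" using B by (subst centre) auto
    moreover have "(0, 0) \<noteq> v" using B(2) by auto
    moreover have "(v, (0, 0)) \<in> parcs ?F" using B(2) by (simp add: parcs_friendship_graph)
    ultimately have "explores ?F {v} ((0, 0) # xs)" by simp
    moreover have "set zs = ?V" unfolding B(1) list.set B(3) using B(2) by blast
    ultimately show ?thesis using B(1,2) unfolding exploration_orders_def V by blast
  next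
    assume "zs \<in> ?C"
    then obtain v xs where C: "zs = v # mate v # (0, 0) # xs" "v \<in> rim m"
      "set xs = rim m - {v, mate v}" "distinct xs"
      by (elim imageE SigmaE) (simp add: permutations_of_set_def)
    note mate = mate_rim[OF C(2)]
    have "explores ?F {(0, 0), mate v, v} xs" using C by (subst centre) auto
    moreover have "(0, 0) \<noteq> v" "(0, 0) \<noteq> mate v" using C(2) mate by auto
    moreover have "(v, (0, 0)) \<in> parcs ?F" "(v, mate v) \<in> parcs ?F"
      using C(2) by (simp_all add: parcs_friendship_graph)
    ultimately have "explores ?F {v} (mate v # (0, 0) # xs)" using mate by simp
    moreover have "set zs = ?V" unfolding C(1) list.set C(3) using C(2) mate by blast
    ultimately show ?thesis using C(1,2) unfolding exploration_orders_def V by blast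
  qed
qed

section \<open>Counting the orders\<close>

lemma card_exploration_orders_friendship_graph:
  assumes "m \<ge> 1"
  shows "card (exploration_orders (friendship_graph m)) =
    fact (2 * m) + 2 * m * fact (2 * m - 1) + 2 * m * fact (2 * m - 2)"
proof -
  let ?SB = "SIGMA v:rim m. permutations_of_set (rim m - {v})"
  let ?SC = "SIGMA v:rim m. permutations_of_set (rim m - {v, mate v})"
  let ?A = "(\<lambda>xs. (0, 0) # xs) ` permutations_of_set (rim m)"
  let ?B = "(\<lambda>(v, xs). v # (0, 0) # xs) ` ?SB"
  let ?C = "(\<lambda>(v, xs). v # mate v # (0, 0) # xs) ` ?SC"
  have "card ?A = fact (2 * m)"
    by (subst card_image) (auto simp: card_rim mult_2)
  moreover have "card ?B = 2 * m * fact (2 * m - 1)"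
  proof -
    have "card ?B = card ?SB" by (rule card_image) (auto simp: inj_on_def)
    also have "\<dots> = (\<Sum>v\<in>rim m. card (permutations_of_set (rim m - {v})))" by simp
    also have "\<dots> = (\<Sum>v\<in>rim m. fact (2 * m - 1))"
      by (intro sum.cong refl) (simp add: card_Diff_singleton card_rim del: One_nat_def)
    finally show ?thesis by (simp add: card_rim)
  qed
  moreover have "card ?C = 2 * m * fact (2 * m - 2)"
  proof -
    have "card ?C = card ?SC" by (rule card_image) (auto simp: inj_on_def)
    also have "\<dots> = (\<Sum>v\<in>rim m. card (permutations_of_set (rim m - {v, mate v})))" by simp
    also have "\<dots> = (\<Sum>v\<in>rim m. fact (2 * m - 2))"
    proof (intro sum.cong refl)
      fix v assume v: "v \<in> rim m"
      \<comment> \<open>A vertex differs from its mate, so exactly two rim vertices are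
        removed.\<close>
      have "card (rim m - {v, mate v}) = card (rim m) - card {v, mate v}"
        using v mate_rim[OF v] by (intro card_Diff_subset) auto
      also have "\<dots> = 2 * m - 2" using mate_rim[OF v] by (subst card_rim) auto
      finally show "card (permutations_of_set (rim m - {v, mate v})) = fact (2 * m - 2)"
        by (subst card_permutations_of_set) auto
    qed
    finally show ?thesis by (simp add: card_rim)
  qed
  \<comment> \<open>The families differ in where the centre stands: first, second or third.\<close>
  moreover have "?A \<inter> ?B = {}" by auto
  moreover have "(?A \<union> ?B) \<inter> ?C = {}"
    using mate_rim by (fastforce simp: mate_def)
  moreover have "finite ?A" "finite ?B" "finite ?C" by auto
  ultimately show ?thesis
    unfolding exploration_orders_friendship_graph[OF assms]
    by (simp add: card_Un_disjoint)
qed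

theorem corollary8:
  fixes m :: nat
  assumes "m \<ge> 1"
  shows "real (num_random_walk_labelings (friendship_graph m))
           = (4 * real m - 1) * fact (2 * m) / (2 * real m - 1)"
proof -
  interpret pair_graph "friendship_graph m" by (rule pair_graph_friendship_graph)
  have sym: "sym (parcs (friendship_graph m))"
    using sym_arcs by (simp add: symmetric_def)
  have sub: "parcs (friendship_graph m) \<subseteq> pverts (friendship_graph m) \<times> pverts (friendship_graph m)"
    using in_arcsD1 in_arcsD2 by auto
  \<comment> \<open>Writing \<open>2 * m\<close> as \<open>n + 2\<close> removes the truncated
    subtractions, lets the factorials unfold, and makes the denominator \<open>n + 1\<close>, which
    is positive.\<close>
  obtain n where n: "2 * m = Suc (Suc n)"
    using assms that[of "2 * m - 2"] by linarith
  then have rm: "2 * real m = real n + 2" by linarith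
  have "real (num_random_walk_labelings (friendship_graph m)) =
      fact (2 * m) + 2 * real m * fact (2 * m - 1) + 2 * real m * fact (2 * m - 2)"
    unfolding num_random_walk_labelings_eq[OF sym sub]
      card_exploration_orders_friendship_graph[OF assms] by simp
  \<comment> \<open>The first two summands are each (2m)!, the third is (2m)!/(2m-1). The factor 4
    is split so that \<open>rm\<close> can rewrite it.\<close>
  also have "\<dots> = (2 * (2 * real m) - 1) * fact (2 * m) / (2 * real m - 1)"
    unfolding n rm by (simp add: field_simps)
  finally show ?thesis unfolding mult.assoc[symmetric] by simp
qed

end
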